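(* Let $\Delta t>0$, let $\hat f_h^{\mathfrak n}=X^\top U^{\mathfrak n}S^{\mathfrak n}(E^{\mathfrak n})^\top Y$ with $U^{\mathfrak n}\in\mathbb R^{m\times r}$, $S^{\mathfrak n}\in\mathbb R^{r\times r}$, $E^{\mathfrak n}\in\mathbb R^{n\times r}$, $(U^{\mathfrak n})^\top U^{\mathfrak n}=I_r$, $(E^{\mathfrak n})^\top A_{\boldsymbol 1}E^{\mathfrak n}=I_r$, and let $\mathbf K^{\mathfrak n+1}\in\mathbb R^{m\times r}$, $\mathbf L^{\mathfrak n+1}\in\mathbb R^{n\times r}$, $S^{\mathfrak n+1}\in\mathbb R^{r\times r}$, where $U^{\mathfrak n+1}$ and $E^{\mathfrak n+1}$ denote the factors from the decompositions $\mathbf K^{\mathfrak n+1}=U^{\mathfrak n+1}R_{\mathbf K}$ with $(U^{\mathfrak n+1})^\top U^{\mathfrak n+1}=I_r$ and $\mathbf L^{\mathfrak n+1}=E^{\mathfrak n+1}R_{\mathbf L}$ with $(E^{\mathfrak n+1})^\top A_{\boldsymbol 1}E^{\mathfrak n+1}=I_r$. Then $\mathbf K^{\mathfrak n+1},\mathbf L^{\mathfrak n+1},S^{\mathfrak n+1}$ solve, respectively, the matrix equations $$\frac{\mathbf K^{\mathfrak n+1}-U^{\mathfrak n}S^{\mathfrak n}}{\Delta t}=G\big(\mathbf K^{\mathfrak n+1}(E^{\mathfrak n})^\top\big)E^{\mathfrak n},$$ $$\frac{\mathbf L^{\mathfrak n+1}-E^{\mathfrak n}(S^{\mathfrak n})^\top}{\Delta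 t}=A_{\boldsymbol 1}^{-1}G\big(U^{\mathfrak n}(\mathbf L^{\mathfrak n+1})^\top\big)^\top U^{\mathfrak n},$$ $$\frac{S^{\mathfrak n+1}-S^{\mathfrak n,*}}{\Delta t}=(U^{\mathfrak n+1})^\top G\big(U^{\mathfrak n+1}S^{\mathfrak n+1}(E^{\mathfrak n+1})^\top\big)E^{\mathfrak n+1},\qquad S^{\mathfrak n,*}=(U^{\mathfrak n+1})^\top U^{\mathfrak n}S^{\mathfrak n}(E^{\mathfrak n})^\top A_{\boldsymbol 1}E^{\mathfrak n+1},$$ if and only if $f_{\mathbf K}^{\mathfrak n+1}:=X^\top\mathbf K^{\mathfrak n+1}(E^{\mathfrak n})^\top Y\in V_1^{\mathfrak n}$, $f_{\mathbf L}^{\mathfrak n+1}:=X^\top U^{\mathfrak n}(\mathbf L^{\mathfrak n+1})^\top Y\in V_2^{\mathfrak n}$ and $f_S^{\mathfrak n+1}:=X^\top U^{\mathfrak n+1}S^{\mathfrak n+1}(E^{\mathfrak n+1})^\top Y\in V_0^{\mathfrak n+1}$ solve $$\Big(\tfrac{f_{\mathbf K}^{\mathfrak n+1}-\hat f_h^{\mathfrak n}}{\Delta t},w_1;\varepsilon^2\Big)_\Omega=\mathcal A(f_{\mathbf K}^{\mathfrak n+1},w_1)\quad\forall w_1\in V_1^{\mathfrak n},$$ $$\Big(\tfrac{f_{\mathbf L}^{\mathfrak n+1}-\hat f_h^{\mathfrak n}}{\Delta t},w_2;\varepsilon^2\Big)_\Omega=\mathcal A(f_{\mathbf L}^{\mathfrak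 n+1},w_2)\quad\forall w_2\in V_2^{\mathfrak n},$$ $$\Big(\tfrac{f_S^{\mathfrak n+1}-\hat f_h^{\mathfrak n}}{\Delta t},w_0;\varepsilon^2\Big)_\Omega=\mathcal A(f_S^{\mathfrak n+1},w_0)\quad\forall w_0\in V_0^{\mathfrak n+1}.$$
   Context: Let $\varepsilon_{\max}>0$, $\Omega=\Omega_\mu\times\Omega_\varepsilon$ with $\Omega_\mu=[-1,1]\ni\mu$, $\Omega_\varepsilon=[0,\varepsilon_{\max}]\ni\varepsilon$. The weighted inner product is $(v,w;\varepsilon^2)_\Omega=\int_0^{\varepsilon_{\max}}\int_{-1}^1 vw\,\varepsilon^2\,d\mu\,d\varepsilon$. The emissivity $\eta=\eta(\varepsilon)>0$ (square integrable with respect to $\varepsilon^2d\varepsilon$) and the opacity $\chi=\chi(\varepsilon)$ are given, with constants $0<\chi_{\min}\le\chi\le\chi_{\max}$. Set $\mathcal A(f,w)=(\eta,w;\varepsilon^2)_\Omega-(\chi f,w;\varepsilon^2)_\Omega$. Partition $\Omega_\mu$ and $\Omega_\varepsilon$ into $N_\mu$ and $N_\varepsilon$ intervals; $V_{\mu,h}$, $V_{\varepsilon,h}$ are the spaces of (discontinuous) piecewise polynomials of degree at most $k$ on these partitions, and $V_h=V_{\mu,h}\otimes V_{\varepsilon,h}$. Let $m=(k+1)N_\mu$, $n=(k+1)N_\varepsilon$, $1\le r\le\min\{m,n\}$. Let $\{x_i(\mu)\}_{i=1}^m$, $\{y_j(\varepsilon)\}_{j=1}^n$ be the bases of $V_{\mu,h}$,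 $V_{\varepsilon,h}$ consisting of Legendre polynomials supported on single cells and orthonormal in the unweighted $L^2$ inner product of the cell; $X(\mu)=[x_1,\dots,x_m]^\top$, $Y(\varepsilon)=[y_1,\dots,y_n]^\top$. The function with coefficient matrix $W\in\mathbb R^{m\times n}$ is $X^\top WY\in V_h$. $A_{\boldsymbol 1}=[\int_{\Omega_\varepsilon}y_iy_j\varepsilon^2d\varepsilon]$ and $A_\chi=[\int_{\Omega_\varepsilon}\chi y_iy_j\varepsilon^2d\varepsilon]$ are symmetric positive definite $n\times n$ matrices. $L_0=[\int_{-1}^1x_i\,d\mu]_i\in\mathbb R^{m\times1}$, $L_\eta=[\int_{\Omega_\varepsilon}\eta y_j\varepsilon^2d\varepsilon]_j\in\mathbb R^{n\times1}$, and $G(F)=L_0L_\eta^\top-FA_\chi$ for $F\in\mathbb R^{m\times n}$. For the time index $\mathfrak n$ (or $\mathfrak n+1$): $V_0^{\mathfrak n}=\{X^\top U^{\mathfrak n}S(E^{\mathfrak n})^\top Y: S\in\mathbb R^{r\times r}\}$, $V_1^{\mathfrak n}=\{X^\top\mathbf K(E^{\mathfrak n})^\top Y:\mathbf K\in\mathbb R^{m\times r}\}$, $V_2^{\mathfrak n}=\{X^\top U^{\mathfrak n}\mathbf L^\top Y:\mathbf L\in\mathbb R^{n\times r}\}$. The factorizations defining $U^{\mathfrak n+1},E^{\mathfrak n+1}$ are a QR factorization and an $A_{\boldsymbol 1}$-weighted QR factorization; they need not be unique and any fixed choice is allowed. *)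

theory Defs
  imports
    "HOL-Analysis.Analysis"
    "HOL-Computational_Algebra.Polynomial"
    "Jordan_Normal_Form.Gauss_Jordan_Elimination"
begin

section \<open>Piecewise polynomials and the Legendre basis\<close>

definition partition_nodes :: "real \<Rightarrow> real \<Rightarrow> nat \<Rightarrow> (nat \<Rightarrow> real) \<Rightarrow> bool" where
  "partition_nodes a b N p \<longleftrightarrow>
     1 \<le> N \<and> p 0 = a \<and> p N = b \<and> strict_mono_on {0..N} p"

text \<open>Cells are half-open, except that the last one contains the right end point, so that the
  cells are disjoint and cover the interval. Values at the nodes do not affect any integral; the
  convention only makes a discontinuous piecewise polynomial a well-defined function.\<close>

definition cell :: "nat \<Rightarrow> (nat \<Rightarrow> real) \<Rightarrow> nat \<Rightarrow> real set" where
  "cell N p c = (if Suc c = N then {p c..p (Suc c)} else {p c..<p (Suc c)})"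

text \<open>Functions on the interval from \<open>p 0\<close> to \<open>p N\<close> are extended by zero.\<close>

definition dg_space :: "nat \<Rightarrow> nat \<Rightarrow> (nat \<Rightarrow> real) \<Rightarrow> (real \<Rightarrow> real) set" where
  "dg_space k N p =
     {v. (\<forall>c<N. \<exists>q::real poly. Polynomial.degree q \<le> k \<and> (\<forall>t\<in>cell N p c. v t = poly q t)) \<and>
         (\<forall>t. t \<notin> {p 0..p N} \<longrightarrow> v t = 0)}"

text \<open>Bonnet's recurrence, normalised so that the value at \<open>1\<close> is \<open>1\<close>.\<close>

fun legendre :: "nat \<Rightarrow> real poly" where
  "legendre 0 = 1"
| "legendre (Suc 0) = [:0, 1:]"
| "legendre (Suc (Suc l)) =
     Polynomial.smult (1 / real (l + 2))
       (Polynomial.smult (real (2 * l + 3)) ([:0, 1:] * legendre (Suc l)) - Polynomial.smult (real (l + 1)) (legendre l))"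

text \<open>The enumeration of the pairs (cell, degree) and the signs are left open. Orthonormality
  forces distinct indices to belong to distinct pairs, and gives the linear independence that makes
  the generating family a basis. As each function lives on one cell, integrating over the whole
  interval is the same as integrating over cells.\<close>

definition legendre_basis :: "nat \<Rightarrow> nat \<Rightarrow> (nat \<Rightarrow> real) \<Rightarrow> (nat \<Rightarrow> real \<Rightarrow> real) \<Rightarrow> bool" where
  "legendre_basis k N p x \<longleftrightarrow>
     (\<forall>i < (k + 1) * N. \<exists>c<N. \<exists>l\<le>k. \<exists>a. x i = (\<lambda>t.
        if t \<in> cell N p c
        then a * poly (legendre l) ((2 * t - p c - p (Suc c)) / (p (Suc c) - p c)) else 0)) \<and>
     (\<forall>i < (k + 1) * N. \<forall>j < (k + 1) * N.
        (LINT t|lebesgue_on {p 0..p N}. x i t * x j t) = (if i = j then 1 else 0)) \<and>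
     dg_space k N p = {\<lambda>t. \<Sum>i < (k + 1) * N. a i * x i t | a. True}"

text \<open>The function \<open>X\<^sup>T W Y\<close> of \<open>(\<mu>, \<epsilon>)\<close>.\<close>

definition coeff_fun :: "nat \<Rightarrow> nat \<Rightarrow> (nat \<Rightarrow> real \<Rightarrow> real) \<Rightarrow> (nat \<Rightarrow> real \<Rightarrow> real) \<Rightarrow>
    real mat \<Rightarrow> real \<Rightarrow> real \<Rightarrow> real" where
  "coeff_fun m n x y W =
     (\<lambda>u e. scalar_prod (Matrix.vec m (\<lambda>i. x i u)) (W *\<^sub>v Matrix.vec n (\<lambda>j. y j e)))"

section \<open>Weighted inner product and the form \<open>\<A>\<close>\<close>

definition winner :: "real \<Rightarrow> (real \<Rightarrow> real \<Rightarrow> real) \<Rightarrow> (real \<Rightarrow> real \<Rightarrow> real) \<Rightarrow> real" where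
  "winner emax v w =
     (LINT e|lebesgue_on {0..emax}. LINT u|lebesgue_on {-1..1}. v u e * w u e * e\<^sup>2)"

definition form_A :: "real \<Rightarrow> (real \<Rightarrow> real) \<Rightarrow> (real \<Rightarrow> real) \<Rightarrow>
    (real \<Rightarrow> real \<Rightarrow> real) \<Rightarrow> (real \<Rightarrow> real \<Rightarrow> real) \<Rightarrow> real" where
  "form_A emax eta chi f w =
     winner emax (\<lambda>u e. eta e) w - winner emax (\<lambda>u e. chi e * f u e) w"

section \<open>Coefficient matrices\<close>

text \<open>\<open>A\<^sub>\<chi>\<close> is \<open>mass_mat emax n y chi\<close>, and \<open>A\<^sub>\<one>\<close> is the case of the constant function \<open>1\<close>.\<close>

definition mass_mat :: "real \<Rightarrow> nat \<Rightarrow> (nat \<Rightarrow> real \<Rightarrow> real) \<Rightarrow> (real \<Rightarrow> real) \<Rightarrow> real mat" where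
  "mass_mat emax n y g =
     Matrix.mat n n (\<lambda>(i, j). LINT e|lebesgue_on {0..emax}. g e * y i e * y j e * e\<^sup>2)"

definition L_zero :: "nat \<Rightarrow> (nat \<Rightarrow> real \<Rightarrow> real) \<Rightarrow> real mat" where
  "L_zero m x = Matrix.mat m 1 (\<lambda>(i, _). LINT u|lebesgue_on {-1..1}. x i u)"

definition L_eta :: "real \<Rightarrow> nat \<Rightarrow> (nat \<Rightarrow> real \<Rightarrow> real) \<Rightarrow> (real \<Rightarrow> real) \<Rightarrow> real mat" where
  "L_eta emax n y eta =
     Matrix.mat n 1 (\<lambda>(j, _). LINT e|lebesgue_on {0..emax}. eta e * y j e * e\<^sup>2)"

definition G_mat :: "real \<Rightarrow> nat \<Rightarrow> nat \<Rightarrow> (nat \<Rightarrow> real \<Rightarrow> real) \<Rightarrow> (nat \<Rightarrow> real \<Rightarrow> real) \<Rightarrow>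
    (real \<Rightarrow> real) \<Rightarrow> (real \<Rightarrow> real) \<Rightarrow> real mat \<Rightarrow> real mat" where
  "G_mat emax m n x y eta chi F =
     L_zero m x * transpose_mat (L_eta emax n y eta) - F * mass_mat emax n y chi"

section \<open>The low-rank spaces\<close>

definition V_zero :: "nat \<Rightarrow> nat \<Rightarrow> nat \<Rightarrow> (nat \<Rightarrow> real \<Rightarrow> real) \<Rightarrow> (nat \<Rightarrow> real \<Rightarrow> real) \<Rightarrow>
    real mat \<Rightarrow> real mat \<Rightarrow> (real \<Rightarrow> real \<Rightarrow> real) set" where
  "V_zero m n r x y U E =
     {coeff_fun m n x y (U * S * transpose_mat E) | S. S \<in> carrier_mat r r}"

definition V_one :: "nat \<Rightarrow> nat \<Rightarrow> nat \<Rightarrow> (nat \<Rightarrow> real \<Rightarrow> real) \<Rightarrow> (nat \<Rightarrow> real \<Rightarrow> real) \<Rightarrow>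
    real mat \<Rightarrow> (real \<Rightarrow> real \<Rightarrow> real) set" where
  "V_one m n r x y E = {coeff_fun m n x y (K * transpose_mat E) | K. K \<in> carrier_mat m r}"

definition V_two :: "nat \<Rightarrow> nat \<Rightarrow> nat \<Rightarrow> (nat \<Rightarrow> real \<Rightarrow> real) \<Rightarrow> (nat \<Rightarrow> real \<Rightarrow> real) \<Rightarrow>
    real mat \<Rightarrow> (real \<Rightarrow> real \<Rightarrow> real) set" where
  "V_two m n r x y U = {coeff_fun m n x y (U * transpose_mat L) | L. L \<in> carrier_mat n r}"

text \<open>\<open>f\<close> is the implicit Euler step of size \<open>dt\<close> from \<open>g\<close>, tested against \<open>V\<close>.\<close>

definition galerkin_step :: "real \<Rightarrow> (real \<Rightarrow> real) \<Rightarrow> (real \<Rightarrow> real) \<Rightarrow> real \<Rightarrow>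
    (real \<Rightarrow> real \<Rightarrow> real) set \<Rightarrow> (real \<Rightarrow> real \<Rightarrow> real) \<Rightarrow> (real \<Rightarrow> real \<Rightarrow> real) \<Rightarrow> bool" where
  "galerkin_step emax eta chi dt V g f \<longleftrightarrow>
     f \<in> V \<and> (\<forall>w\<in>V. winner emax (\<lambda>u e. (f u e - g u e) / dt) w = form_A emax eta chi f w)"

end

theory Submission
  imports Defs "Jordan_Normal_Form.Determinant"
begin

text \<open>
  A function in the tensor product space is its coefficient matrix, and testing an equation against
  such functions is taking Frobenius inner products of matrices. Since the weight depends on
  \<open>\<epsilon>\<close> alone and the \<open>x\<^sub>i\<close> are orthonormal, the weighted inner product of \<open>g X\<^sup>T F Y\<close> and
  \<open>X\<^sup>T W Y\<close> is the Frobenius product of \<open>F A\<^sub>g\<close> and \<open>W\<close>, where \<open>A\<^sub>g\<close> is the mass matrix for the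
  weight \<open>g \<epsilon>\<^sup>2\<close> (\<open>winner_coeff_fun\<close>), and the source term is the Frobenius product of
  \<open>L\<^sub>0 L\<^sub>\<eta>\<^sup>T\<close> and \<open>W\<close> (\<open>winner_source\<close>). An implicit Euler step from \<open>F\<^sub>0\<close> to \<open>F\<close>
  therefore says that the residual
  \<open>M = (F - F\<^sub>0) A\<^sub>\<one> / \<Delta>t - G(F)\<close> is Frobenius-orthogonal to all admissible test matrices \<open>W\<close>.

  The three test spaces have one shape: \<open>W = P Z Q\<^sup>T\<close> with \<open>P\<close>, \<open>Q\<close> given and \<open>Z\<close> arbitrary.
  Moving \<open>P\<close> and \<open>Q\<close> to the other side of the Frobenius product, orthogonality becomes
  \<open>P\<^sup>T M Q = 0\<close> (\<open>galerkin_step_iff_residual\<close>). The choices are \<open>P = I, Q = E\<close> for the K-step,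
  \<open>P = U, Q = I\<close> for the L-step, and \<open>P = U', Q = E'\<close> for the S-step. The normalisations of
  \<open>U\<close>, \<open>E\<close>, \<open>U'\<close>, \<open>E'\<close> turn \<open>P\<^sup>T M Q = 0\<close> into the stated matrix
  equations (\<open>normalised_residual_eq_zero_iff\<close>, \<open>left_normalised_residual_eq_zero_iff\<close>). Only in
  the L-step, where \<open>Q = I\<close> is not normalised, does a factor \<open>A\<^sub>\<one>\<close> survive; it is invertible
  because its quadratic form is the weighted norm of a combination of the linearly independent
  \<open>y\<^sub>j\<close> (\<open>mass_mat_inverse\<close>).

  All integrals that are interchanged with finite sums exist: the basis functions are
  bounded and Borel measurable, \<open>\<chi>\<close> is bounded, and \<open>\<eta>\<close> is square integrable for the weight.
\<close>

section \<open>The Frobenius pairing of coefficient matrices\<close>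

text \<open>The trace of \<open>A B\<^sup>T\<close>, written entrywise to match the double sums that integration produces.\<close>

definition frob :: "real mat \<Rightarrow> real mat \<Rightarrow> real" where
  "frob A B = (\<Sum>i<dim_row A. \<Sum>j<dim_col A. A $$ (i, j) * B $$ (i, j))"

lemma frob_eq:
  assumes "A \<in> carrier_mat m n"
  shows "frob A B = (\<Sum>i<m. \<Sum>j<n. A $$ (i, j) * B $$ (i, j))"
  using assms by (auto simp: frob_def)

lemma frob_diff_left:
  assumes "A \<in> carrier_mat m n" "B \<in> carrier_mat m n"
  shows "frob (A - B) C = frob A C - frob B C"
  using assms
  by (auto simp: frob_def sum_subtractf[symmetric] algebra_simps intro!: sum.cong)

lemma index_mult_mat_sum:
  assumes "A \<in> carrier_mat m k" "B \<in> carrier_mat k n" "i < m" "j < n"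
  shows "(A * B) $$ (i, j) = (\<Sum>l<k. A $$ (i, l) * B $$ (l, j))"
  using assms by (auto simp: scalar_prod_def lessThan_atLeast0 intro!: sum.cong)

lemma frob_mult_right_adjoint:
  assumes "M \<in> carrier_mat m n" "A \<in> carrier_mat m k" "Q \<in> carrier_mat n k"
  shows "frob M (A * transpose_mat Q) = frob (M * Q) A"
proof -
  have "frob M (A * transpose_mat Q)
      = (\<Sum>i<m. \<Sum>j<n. \<Sum>l<k. M $$ (i, j) * (A $$ (i, l) * Q $$ (j, l)))"
    using assms
    by (simp add: frob_eq index_mult_mat_sum[of _ m k _ n] sum_distrib_left del: index_mult_mat(1))
  also have "\<dots> = (\<Sum>i<m. \<Sum>l<k. \<Sum>j<n. M $$ (i, j) * (A $$ (i, l) * Q $$ (j, l)))"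
    by (intro sum.cong refl sum.swap)
  also have "\<dots> = frob (M * Q) A"
    using assms
    by (simp add: frob_eq[of _ m k] index_mult_mat_sum[of _ m n _ k] sum_distrib_left sum_distrib_right
        mult_ac del: index_mult_mat(1))
  finally show ?thesis .
qed

lemma frob_transpose:
  assumes "A \<in> carrier_mat m n" "B \<in> carrier_mat m n"
  shows "frob (transpose_mat A) (transpose_mat B) = frob A B"
proof -
  have "frob (transpose_mat A) (transpose_mat B) = (\<Sum>j<n. \<Sum>i<m. A $$ (i, j) * B $$ (i, j))"
    using assms by (simp add: frob_eq[of _ n m])
  also have "\<dots> = frob A B"
    using assms by (simp add: frob_eq sum.swap[of _ "{..<n}"])
  finally show ?thesis .
qed

text \<open>The right adjoint rule, conjugated by transposition.\<close>

lemma frob_mult_left_adjoint: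
  assumes "M \<in> carrier_mat m n" "P \<in> carrier_mat m k" "B \<in> carrier_mat k n"
  shows "frob M (P * B) = frob (transpose_mat P * M) B"
proof -
  have "frob M (P * B) = frob (transpose_mat M) (transpose_mat B * transpose_mat P)"
    using assms frob_transpose[of M m n "P * B"] by (simp add: transpose_mult[of P m k B n])
  also have "\<dots> = frob (transpose_mat M * P) (transpose_mat B)"
    using assms by (intro frob_mult_right_adjoint[of _ n m _ k]) auto
  also have "transpose_mat M * P = transpose_mat (transpose_mat P * M)"
    using assms by (simp add: transpose_mult[of _ k m _ n])
  also have "frob \<dots> (transpose_mat B) = frob (transpose_mat P * M) B"
    using assms by (intro frob_transpose[of _ k n]) auto
  finally show ?thesis .
qed

text \<open>The Frobenius product is definite, so testing \<open>M\<close> against itself suffices.\<close>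

lemma frob_orthogonal_all_iff:
  assumes M: "M \<in> carrier_mat m n"
  shows "(\<forall>Z\<in>carrier_mat m n. frob M Z = 0) \<longleftrightarrow> M = 0\<^sub>m m n"
proof
  assume "\<forall>Z\<in>carrier_mat m n. frob M Z = 0"
  then have "(\<Sum>i<m. \<Sum>j<n. M $$ (i, j) * M $$ (i, j)) = 0"
    unfolding frob_eq[OF M] using M by (rule bspec)
  then have "M $$ (i, j) = 0" if "i < m" "j < n" for i j
    using that by (subst (asm) sum_nonneg_eq_0_iff)
      (auto simp: sum_nonneg sum_nonneg_eq_0_iff)
  then show "M = 0\<^sub>m m n"
    using M by (intro eq_matI) auto
qed (auto simp: frob_def)

text \<open>All three low-rank spaces consist of the matrices \<open>P Z Q\<^sup>T\<close> for suitable \<open>P\<close> and \<open>Q\<close>; moving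
  these to the other argument leaves an unconstrained test matrix \<open>Z\<close>.\<close>

lemma frob_orthogonal_sandwich_iff:
  assumes M: "M \<in> carrier_mat m n" and P: "P \<in> carrier_mat m a" and Q: "Q \<in> carrier_mat n b"
  shows "(\<forall>Z\<in>carrier_mat a b. frob M (P * Z * transpose_mat Q) = 0) \<longleftrightarrow>
    transpose_mat P * M * Q = 0\<^sub>m a b"
proof -
  have "frob M (P * Z * transpose_mat Q) = frob (transpose_mat P * M * Q) Z"
    if Z: "Z \<in> carrier_mat a b" for Z
  proof -
    have "frob M (P * Z * transpose_mat Q) = frob (M * Q) (P * Z)"
      using M P Q Z by (intro frob_mult_right_adjoint[of _ m n _ b]) auto
    also have "\<dots> = frob (transpose_mat P * (M * Q)) Z"
      using M P Q Z by (intro frob_mult_left_adjoint[of _ m b _ a]) auto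
    also have "transpose_mat P * (M * Q) = transpose_mat P * M * Q"
      using M P Q by (intro assoc_mult_mat[symmetric, of _ a m _ n _ b]) auto
    finally show ?thesis .
  qed
  then show ?thesis
    using frob_orthogonal_all_iff[OF mult_carrier_mat[OF mult_carrier_mat[OF
        transpose_carrier_mat[THEN iffD2, OF P] M] Q]] by (simp only: cong: ball_cong)
qed

section \<open>Inner products of functions in terms of coefficient matrices\<close>

lemma mass_mat_carrier: "mass_mat emax n y g \<in> carrier_mat n n"
  by (simp add: mass_mat_def)

lemma mass_mat_symmetric: "transpose_mat (mass_mat emax n y g) = mass_mat emax n y g"
  unfolding mass_mat_def by (intro eq_matI) (simp_all add: mult.left_commute mult.commute)

lemma G_mat_carrier:
  assumes "F \<in> carrier_mat m n"
  shows "G_mat emax m n x y eta chi F \<in> carrier_mat m n"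
  unfolding G_mat_def by (intro minus_carrier_mat mult_carrier_mat[OF assms mass_mat_carrier])

lemma coeff_fun_sum:
  assumes "W \<in> carrier_mat m n"
  shows "coeff_fun m n x y W u e = (\<Sum>i<m. x i u * (\<Sum>j<n. W $$ (i, j) * y j e))"
  using assms
  by (auto simp: coeff_fun_def scalar_prod_def lessThan_atLeast0 intro!: sum.cong)

lemma coeff_fun_scaled_diff:
  assumes "F \<in> carrier_mat m n" "F0 \<in> carrier_mat m n"
  shows "coeff_fun m n x y (c \<cdot>\<^sub>m (F - F0)) u e
    = c * (coeff_fun m n x y F u e - coeff_fun m n x y F0 u e)"
proof -
  have "c \<cdot>\<^sub>m (F - F0) \<in> carrier_mat m n"
    by (intro smult_carrier_mat minus_carrier_mat assms)
  then show ?thesis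
    using assms
    by (simp add: coeff_fun_sum[of _ m n] sum_subtractf sum_distrib_left algebra_simps)
qed

lemma integral_double_sum:
  fixes f :: "nat \<Rightarrow> nat \<Rightarrow> 'a \<Rightarrow> real"
  assumes "\<And>i j. i < m \<Longrightarrow> j < n \<Longrightarrow> integrable M (f i j)"
  shows "integrable M (\<lambda>t. \<Sum>i<m. \<Sum>j<n. c i j * f i j t)"
    and "(LINT t|M. (\<Sum>i<m. \<Sum>j<n. c i j * f i j t)) = (\<Sum>i<m. \<Sum>j<n. c i j * (LINT t|M. f i j t))"
proof -
  have inner: "integrable M (\<lambda>t. \<Sum>j<n. c i j * f i j t)" if "i < m" for i
    using that by (intro Bochner_Integration.integrable_sum integrable_mult_right assms) auto
  show "integrable M (\<lambda>t. \<Sum>i<m. \<Sum>j<n. c i j * f i j t)"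
    by (intro Bochner_Integration.integrable_sum inner) simp
  have "(LINT t|M. (\<Sum>i<m. \<Sum>j<n. c i j * f i j t)) = (\<Sum>i<m. LINT t|M. (\<Sum>j<n. c i j * f i j t))"
    by (intro Bochner_Integration.integral_sum inner) simp
  also have "\<dots> = (\<Sum>i<m. \<Sum>j<n. LINT t|M. c i j * f i j t)"
    using assms by (intro sum.cong refl Bochner_Integration.integral_sum) auto
  finally show "(LINT t|M. (\<Sum>i<m. \<Sum>j<n. c i j * f i j t))
      = (\<Sum>i<m. \<Sum>j<n. c i j * (LINT t|M. f i j t))"
    by simp
qed

text \<open>Integrating over \<open>\<mu>\<close> first, orthonormality of the \<open>x\<^sub>i\<close> collapses the two row sums to one. What
  is left is a sum of integrals over \<open>\<epsilon>\<close>, which are the entries of the mass matrix. The weight \<open>g\<close>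
  covers both the time derivative (\<open>g = 1\<close>) and the absorption term (\<open>g = \<chi>\<close>).\<close>

lemma winner_coeff_fun:
  assumes int_x: "\<And>i j. i < m \<Longrightarrow> j < m \<Longrightarrow>
      integrable (lebesgue_on {-1..1}) (\<lambda>u. x i u * x j u)"
    and orth_x: "\<And>i j. i < m \<Longrightarrow> j < m \<Longrightarrow>
      (LINT u|lebesgue_on {-1..1}. x i u * x j u) = (if i = j then 1 else 0)"
    and int_y: "\<And>i j. i < n \<Longrightarrow> j < n \<Longrightarrow>
      integrable (lebesgue_on {0..emax}) (\<lambda>e. g e * y i e * y j e * e\<^sup>2)"
    and F: "F \<in> carrier_mat m n" and W: "W \<in> carrier_mat m n"
  shows "winner emax (\<lambda>u e. g e * coeff_fun m n x y F u e) (coeff_fun m n x y W)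
    = frob (F * mass_mat emax n y g) W"
proof -
  define a where "a = (\<lambda>A i e. \<Sum>j<n. A $$ (i, j) * y j e)"
  have cf: "coeff_fun m n x y A u e = (\<Sum>i<m. x i u * a A i e)"
    if "A \<in> carrier_mat m n" for A u e
    using that by (simp add: coeff_fun_sum a_def)
  have inner: "(LINT u|lebesgue_on {-1..1}.
        g e * coeff_fun m n x y F u e * coeff_fun m n x y W u e * e\<^sup>2)
      = (\<Sum>i<m. \<Sum>j<n. \<Sum>l<n. F $$ (i, j) * W $$ (i, l) * (g e * y j e * y l e * e\<^sup>2))" for e
  proof -
    have "(LINT u|lebesgue_on {-1..1}.
        g e * coeff_fun m n x y F u e * coeff_fun m n x y W u e * e\<^sup>2)
      = (LINT u|lebesgue_on {-1..1}.
          (\<Sum>i<m. \<Sum>i'<m. (g e * a F i e * a W i' e * e\<^sup>2) * (x i u * x i' u)))"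
      using F W by (intro Bochner_Integration.integral_cong refl)
        (simp add: cf sum_product sum_distrib_left sum_distrib_right mult_ac)
    also have "\<dots> = (\<Sum>i<m. \<Sum>i'<m. (g e * a F i e * a W i' e * e\<^sup>2) * (if i = i' then 1 else 0))"
      using int_x orth_x by (subst integral_double_sum(2)) auto
    also have "\<dots> = (\<Sum>i<m. g e * a F i e * a W i e * e\<^sup>2)"
      by (simp add: if_distrib sum.delta cong: if_cong)
    also have "\<dots> = (\<Sum>i<m. \<Sum>j<n. \<Sum>l<n. F $$ (i, j) * W $$ (i, l) * (g e * y j e * y l e * e\<^sup>2))"
      unfolding a_def
      by (intro sum.cong refl) (simp add: sum_product sum_distrib_left sum_distrib_right mult_ac)
    finally show ?thesis .
  qed
  have "winner emax (\<lambda>u e. g e * coeff_fun m n x y F u e) (coeff_fun m n x y W)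
     = (LINT e|lebesgue_on {0..emax}. (\<Sum>i<m. \<Sum>j<n. \<Sum>l<n.
          F $$ (i, j) * W $$ (i, l) * (g e * y j e * y l e * e\<^sup>2)))"
    unfolding winner_def inner ..
  also have "\<dots> = (\<Sum>i<m. \<Sum>j<n. \<Sum>l<n. F $$ (i, j) * W $$ (i, l) * mass_mat emax n y g $$ (j, l))"
  proof (subst Bochner_Integration.integral_sum)
    show "integrable (lebesgue_on {0..emax}) (\<lambda>e. \<Sum>j<n. \<Sum>l<n.
        F $$ (i, j) * W $$ (i, l) * (g e * y j e * y l e * e\<^sup>2))" for i
      by (rule integral_double_sum(1)[OF int_y])
  qed (simp add: integral_double_sum(2)[OF int_y] mass_mat_def)
  also have "\<dots> = (\<Sum>i<m. \<Sum>l<n. \<Sum>j<n. F $$ (i, j) * W $$ (i, l) * mass_mat emax n y g $$ (j, l))"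
    by (intro sum.cong refl sum.swap)
  also have "\<dots> = frob (F * mass_mat emax n y g) W"
  proof -
    note mass_mat_carrier[of emax n y g]
    then show ?thesis
      using F by (simp add: frob_eq[of _ m n] index_mult_mat_sum[of _ m n _ n] sum_distrib_left
          sum_distrib_right mult_ac del: index_mult_mat(1))
  qed
  finally show ?thesis .
qed

text \<open>The emissivity is constant in \<open>\<mu>\<close>, so the source integral splits into the factors collected in
  \<open>L\<^sub>0\<close> and \<open>L\<^sub>\<eta>\<close>, and its matrix has rank one.\<close>

lemma winner_source:
  assumes int_x: "\<And>i. i < m \<Longrightarrow> integrable (lebesgue_on {-1..1}) (x i)"
    and int_y: "\<And>j. j < n \<Longrightarrow> integrable (lebesgue_on {0..emax}) (\<lambda>e. eta e * y j e * e\<^sup>2)"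
    and W: "W \<in> carrier_mat m n"
  shows "winner emax (\<lambda>u e. eta e) (coeff_fun m n x y W)
    = frob (L_zero m x * transpose_mat (L_eta emax n y eta)) W"
proof -
  define c where "c = (\<lambda>i. LINT u|lebesgue_on {-1..1}. x i u)"
  have inner: "(LINT u|lebesgue_on {-1..1}. eta e * coeff_fun m n x y W u e * e\<^sup>2)
      = (\<Sum>i<m. \<Sum>j<n. c i * W $$ (i, j) * (eta e * y j e * e\<^sup>2))" for e
  proof -
    have "(LINT u|lebesgue_on {-1..1}. eta e * coeff_fun m n x y W u e * e\<^sup>2)
      = (LINT u|lebesgue_on {-1..1}. (\<Sum>i<m. (\<Sum>j<n. W $$ (i, j) * (eta e * y j e * e\<^sup>2)) * x i u))"
      using W by (intro Bochner_Integration.integral_cong refl)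
        (simp add: coeff_fun_sum sum_distrib_left sum_distrib_right mult_ac)
    also have "\<dots> = (\<Sum>i<m. (\<Sum>j<n. W $$ (i, j) * (eta e * y j e * e\<^sup>2)) * c i)"
      using int_x by (simp add: Bochner_Integration.integral_sum c_def)
    finally show ?thesis
      by (simp add: sum_distrib_left sum_distrib_right mult_ac)
  qed
  have "winner emax (\<lambda>u e. eta e) (coeff_fun m n x y W)
     = (LINT e|lebesgue_on {0..emax}. (\<Sum>i<m. \<Sum>j<n. c i * W $$ (i, j) * (eta e * y j e * e\<^sup>2)))"
    unfolding winner_def inner ..
  also have "\<dots> = (\<Sum>i<m. \<Sum>j<n. c i * W $$ (i, j) * (LINT e|lebesgue_on {0..emax}. eta e * y j e * e\<^sup>2))"
    using int_y by (intro integral_double_sum(2)) auto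
  also have "\<dots> = frob (L_zero m x * transpose_mat (L_eta emax n y eta)) W"
  proof -
    have "L_zero m x * transpose_mat (L_eta emax n y eta)
        = Matrix.mat m n (\<lambda>(i, j). c i * (LINT e|lebesgue_on {0..emax}. eta e * y j e * e\<^sup>2))"
      by (intro eq_matI) (simp_all add: L_zero_def L_eta_def c_def scalar_prod_def)
    then show ?thesis
      by (simp add: frob_def mult_ac)
  qed
  finally show ?thesis .
qed

section \<open>Integrability for the Legendre bases\<close>

text \<open>A basis function agrees with a polynomial on one cell, whose closure is compact, and vanishes
  elsewhere.\<close>

lemma legendre_basis_bounded_borel:
  assumes "legendre_basis k N p x" "i < (k + 1) * N"
  shows "x i \<in> borel_measurable borel" and "\<exists>C. \<forall>t. \<bar>x i t\<bar> \<le> C"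
proof -
  obtain c l a where xi: "x i = (\<lambda>t. if t \<in> cell N p c
        then a * poly (legendre l) ((2 * t - p c - p (Suc c)) / (p (Suc c) - p c)) else 0)"
    using assms unfolding legendre_basis_def by blast
  define h where "h = (\<lambda>t. a * poly (legendre l) ((2 * t - p c - p (Suc c)) * inverse (p (Suc c) - p c)))"
  have xi_h: "x i = (\<lambda>t. if t \<in> cell N p c then h t else 0)"
    unfolding xi h_def divide_inverse ..
  have cont: "continuous_on UNIV h"
    unfolding h_def by (intro continuous_intros)
  then have "h \<in> borel_measurable borel"
    by (rule borel_measurable_continuous_onI)
  moreover have "cell N p c \<in> sets borel"
    by (simp add: cell_def)
  ultimately show "x i \<in> borel_measurable borel"
    unfolding xi_h by (intro measurable_If_set) auto
  have "compact (h ` {p c..p (Suc c)})"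
    using cont by (intro compact_continuous_image) (auto intro: continuous_on_subset)
  then have "bounded (h ` {p c..p (Suc c)})"
    by (rule compact_imp_bounded)
  then obtain C where C: "\<forall>t\<in>{p c..p (Suc c)}. \<bar>h t\<bar> \<le> C"
    by (auto simp: bounded_iff)
  have "cell N p c \<subseteq> {p c..p (Suc c)}"
    by (auto simp: cell_def)
  then have "\<bar>x i t\<bar> \<le> max C 0" for t
    using C by (auto simp: xi_h le_max_iff_disj)
  then show "\<exists>C. \<forall>t. \<bar>x i t\<bar> \<le> C"
    by blast
qed

lemma borel_measurable_lebesgue_onI:
  assumes "(f :: real \<Rightarrow> real) \<in> borel_measurable borel"
  shows "f \<in> borel_measurable (lebesgue_on S)"
  using assms by (intro measurable_restrict_space1 measurable_completion) simp

lemma integrable_lebesgue_on_bounded: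
  fixes f :: "real \<Rightarrow> real"
  assumes "f \<in> borel_measurable (lebesgue_on {a..b})" and "\<And>t. t \<in> {a..b} \<Longrightarrow> \<bar>f t\<bar> \<le> C"
  shows "integrable (lebesgue_on {a..b}) f"
proof -
  interpret finite_measure "lebesgue_on {a..b}"
    by (intro finite_measure_lebesgue_on) simp
  show ?thesis
    using assms by (intro integrable_const_bound[of _ C] AE_I2) (auto simp: space_restrict_space)
qed

lemma integrable_weighted_basis_product:
  assumes basis: "legendre_basis k N p y" and ij: "i < (k + 1) * N" "j < (k + 1) * N"
    and g: "g \<in> borel_measurable (lebesgue_on {a..b})" "\<And>t. t \<in> {a..b} \<Longrightarrow> \<bar>g t\<bar> \<le> B"
  shows "integrable (lebesgue_on {a..b}) (\<lambda>t. g t * y i t * y j t)"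
proof -
  obtain C D where C: "\<And>t. \<bar>y i t\<bar> \<le> C" and D: "\<And>t. \<bar>y j t\<bar> \<le> D"
    using legendre_basis_bounded_borel(2)[OF basis] ij by metis
  have [measurable]: "y i \<in> borel_measurable (lebesgue_on {a..b})"
      "y j \<in> borel_measurable (lebesgue_on {a..b})"
    by (intro borel_measurable_lebesgue_onI legendre_basis_bounded_borel(1)[OF basis] ij)+
  note g(1)[measurable]
  show ?thesis
  proof (rule integrable_lebesgue_on_bounded)
    show "\<bar>g t * y i t * y j t\<bar> \<le> B * C * D" if "t \<in> {a..b}" for t
    proof -
      have "0 \<le> B" "0 \<le> C"
        by (rule order_trans[OF abs_ge_zero g(2)[OF that]]) (rule order_trans[OF abs_ge_zero C])
      then show ?thesis
        unfolding abs_mult by (intro mult_mono g(2)[OF that] C D) simp_all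
    qed
  qed measurable
qed

lemma integrable_basis_product:
  assumes "legendre_basis k N p y" and "i < (k + 1) * N" "j < (k + 1) * N"
  shows "integrable (lebesgue_on {a..b}) (\<lambda>t. y i t * y j t)"
  using integrable_weighted_basis_product[OF assms, where g = "\<lambda>_. 1" and B = 1] by simp

lemma integrable_squared_weight_product:
  assumes basis: "legendre_basis k N p y" and ij: "i < (k + 1) * N" "j < (k + 1) * N"
    and g: "g \<in> borel_measurable (lebesgue_on {a..b})" "\<And>t. t \<in> {a..b} \<Longrightarrow> \<bar>g t\<bar> \<le> B"
  shows "integrable (lebesgue_on {a..b}) (\<lambda>t. g t * y i t * y j t * t\<^sup>2)"
proof -
  define D where "D = \<bar>a\<bar> + \<bar>b\<bar>"
  have "(\<lambda>t. t\<^sup>2) \<in> borel_measurable (lebesgue_on {a..b})"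
    by (rule borel_measurable_lebesgue_onI) simp
  then have "(\<lambda>t. g t * t\<^sup>2) \<in> borel_measurable (lebesgue_on {a..b})"
    by (rule borel_measurable_times[OF g(1)])
  moreover have "\<bar>g t * t\<^sup>2\<bar> \<le> B * D\<^sup>2" if t: "t \<in> {a..b}" for t
  proof -
    have "\<bar>t\<bar> \<le> D"
      using t by (simp add: D_def) linarith
    then have "\<bar>t\<bar>\<^sup>2 \<le> D\<^sup>2"
      by (rule power_mono) (rule abs_ge_zero)
    then have "t\<^sup>2 \<le> D\<^sup>2"
      by (simp only: power2_abs)
    moreover have "0 \<le> B"
      by (rule order_trans[OF abs_ge_zero g(2)[OF t]])
    ultimately show ?thesis
      unfolding abs_mult abs_power2 by (intro mult_mono g(2)[OF t] zero_le_power2)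
  qed
  ultimately have "integrable (lebesgue_on {a..b}) (\<lambda>t. g t * t\<^sup>2 * y i t * y j t)"
    by (rule integrable_weighted_basis_product[OF basis ij, where g = "\<lambda>t. g t * t\<^sup>2"])
  moreover have "(\<lambda>t. g t * t\<^sup>2 * y i t * y j t) = (\<lambda>t. g t * y i t * y j t * t\<^sup>2)"
    by (intro ext) (simp only: mult_ac)
  ultimately show ?thesis
    by (simp only:)
qed

lemma integrable_basis:
  assumes basis: "legendre_basis k N p x" and i: "i < (k + 1) * N"
  shows "integrable (lebesgue_on {a..b}) (x i)"
proof -
  obtain C where "\<And>t. \<bar>x i t\<bar> \<le> C"
    using legendre_basis_bounded_borel(2)[OF basis i] by metis
  then show ?thesis
    using legendre_basis_bounded_borel(1)[OF basis i]
    by (intro integrable_lebesgue_on_bounded[of _ _ _ C] borel_measurable_lebesgue_onI)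
qed

text \<open>The emissivity is only square integrable for the weight, hence the domination
  \<open>\<bar>\<eta>\<bar> \<le> \<eta>\<^sup>2 + 1\<close>, both of whose terms are integrable against \<open>\<epsilon>\<^sup>2\<close> on a bounded interval.\<close>

lemma integrable_source_basis:
  assumes basis: "legendre_basis k N p y" and j: "j < (k + 1) * N"
    and eta: "eta \<in> borel_measurable (lebesgue_on {a..b})"
    and eta_sq: "integrable (lebesgue_on {a..b}) (\<lambda>e. (eta e)\<^sup>2 * e\<^sup>2)"
  shows "integrable (lebesgue_on {a..b}) (\<lambda>e. eta e * y j e * e\<^sup>2)"
proof -
  obtain C where C: "\<And>t. \<bar>y j t\<bar> \<le> C"
    using legendre_basis_bounded_borel(2)[OF basis j] by metis
  have [measurable]: "y j \<in> borel_measurable (lebesgue_on {a..b})"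
    using legendre_basis_bounded_borel(1)[OF basis j] by (rule borel_measurable_lebesgue_onI)
  have [measurable]: "(\<lambda>e. e) \<in> borel_measurable (lebesgue_on {a..b})"
    by (rule borel_measurable_lebesgue_onI) simp
  note eta[measurable]
  have "integrable (lebesgue_on {a..b}) (\<lambda>e. e\<^sup>2 :: real)"
  proof (rule integrable_lebesgue_on_bounded)
    show "\<bar>t\<^sup>2\<bar> \<le> (\<bar>a\<bar> + \<bar>b\<bar>)\<^sup>2" if "t \<in> {a..b}" for t
    proof -
      have "\<bar>t\<bar> \<le> \<bar>\<bar>a\<bar> + \<bar>b\<bar>\<bar>"
        using that by simp linarith
      then show ?thesis
        unfolding abs_power2 by (simp only: abs_le_square_iff)
    qed
  qed measurable
  then have dom: "integrable (lebesgue_on {a..b}) (\<lambda>e. C * ((eta e)\<^sup>2 * e\<^sup>2 + e\<^sup>2))"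
    using eta_sq by (intro integrable_mult_right Bochner_Integration.integrable_add)
  have bound: "\<bar>eta e * y j e * e\<^sup>2\<bar> \<le> C * ((eta e)\<^sup>2 * e\<^sup>2 + e\<^sup>2)" for e
  proof -
    have "0 \<le> (\<bar>eta e\<bar> - 1)\<^sup>2"
      by simp
    then have "2 * \<bar>eta e\<bar> \<le> (eta e)\<^sup>2 + 1"
      by (simp add: power2_eq_square algebra_simps)
    then have "\<bar>eta e\<bar> \<le> (eta e)\<^sup>2 + 1"
      by linarith
    then have "\<bar>y j e\<bar> * \<bar>eta e\<bar> \<le> C * ((eta e)\<^sup>2 + 1)"
      by (intro mult_mono C order_trans[OF abs_ge_zero C] abs_ge_zero)
    then have "\<bar>y j e\<bar> * \<bar>eta e\<bar> * e\<^sup>2 \<le> C * ((eta e)\<^sup>2 + 1) * e\<^sup>2"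
      by (intro mult_right_mono) auto
    then show ?thesis
      by (simp add: abs_mult algebra_simps)
  qed
  show ?thesis
  proof (rule Bochner_Integration.integrable_bound[OF dom])
    show "AE e in lebesgue_on {a..b}. norm (eta e * y j e * e\<^sup>2)
        \<le> norm (C * ((eta e)\<^sup>2 * e\<^sup>2 + e\<^sup>2))"
      unfolding real_norm_def by (intro AE_I2 order_trans[OF bound abs_ge_self])
  qed measurable
qed

section \<open>Invertibility of the weighted mass matrix\<close>

lemma mass_mat_quadratic_form:
  assumes int: "\<And>i j. i < n \<Longrightarrow> j < n \<Longrightarrow>
      integrable (lebesgue_on {0..emax}) (\<lambda>e. g e * y i e * y j e * e\<^sup>2)"
    and v: "v \<in> carrier_vec n"
  shows "integrable (lebesgue_on {0..emax}) (\<lambda>e. g e * (\<Sum>j<n. Matrix.vec_index v j * y j e)\<^sup>2 * e\<^sup>2)"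
    and "scalar_prod v (mass_mat emax n y g *\<^sub>v v)
      = (LINT e|lebesgue_on {0..emax}. g e * (\<Sum>j<n. Matrix.vec_index v j * y j e)\<^sup>2 * e\<^sup>2)"
proof -
  have eq: "(\<lambda>e. g e * (\<Sum>j<n. Matrix.vec_index v j * y j e)\<^sup>2 * e\<^sup>2)
      = (\<lambda>e. \<Sum>i<n. \<Sum>j<n. (Matrix.vec_index v i * Matrix.vec_index v j) * (g e * y i e * y j e * e\<^sup>2))"
    by (simp add: power2_eq_square sum_product sum_distrib_left sum_distrib_right mult_ac)
  show "integrable (lebesgue_on {0..emax}) (\<lambda>e. g e * (\<Sum>j<n. Matrix.vec_index v j * y j e)\<^sup>2 * e\<^sup>2)"
    unfolding eq using int by (rule integral_double_sum(1))
  have "scalar_prod v (mass_mat emax n y g *\<^sub>v v)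
      = (\<Sum>i<n. \<Sum>j<n. (Matrix.vec_index v i * Matrix.vec_index v j) * (LINT e|lebesgue_on {0..emax}. g e * y i e * y j e * e\<^sup>2))"
    using v by (simp add: scalar_prod_def mass_mat_def lessThan_atLeast0 sum_distrib_left mult_ac)
  also have "\<dots> = (LINT e|lebesgue_on {0..emax}. g e * (\<Sum>j<n. Matrix.vec_index v j * y j e)\<^sup>2 * e\<^sup>2)"
    unfolding eq using int by (rule integral_double_sum(2)[symmetric])
  finally show "scalar_prod v (mass_mat emax n y g *\<^sub>v v)
      = (LINT e|lebesgue_on {0..emax}. g e * (\<Sum>j<n. Matrix.vec_index v j * y j e)\<^sup>2 * e\<^sup>2)" .
qed

text \<open>For a kernel vector \<open>v\<close>, the integral of the square of \<open>s = \<Sum>v\<^sub>j y\<^sub>j\<close> against \<open>\<epsilon>\<^sup>2\<close> vanishes. The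
  weight is zero only at \<open>\<epsilon> = 0\<close>, a null set, so \<open>s\<close> is zero almost everywhere; by
  orthonormality without the weight, the squared norm of \<open>s\<close> is that of \<open>v\<close>, so \<open>v = 0\<close>.\<close>

lemma mass_mat_inverse:
  assumes int: "\<And>i j. i < n \<Longrightarrow> j < n \<Longrightarrow>
      integrable (lebesgue_on {0..emax}) (\<lambda>e. 1 * y i e * y j e * e\<^sup>2)"
    and int1: "\<And>i j. i < n \<Longrightarrow> j < n \<Longrightarrow>
      integrable (lebesgue_on {0..emax}) (\<lambda>e. y i e * y j e)"
    and orth: "\<And>i j. i < n \<Longrightarrow> j < n \<Longrightarrow>
      (LINT e|lebesgue_on {0..emax}. y i e * y j e) = (if i = j then 1 else 0)"
  defines "A \<equiv> mass_mat emax n y (\<lambda>_. 1)"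
  shows "A * the (mat_inverse A) = 1\<^sub>m n" and "the (mat_inverse A) * A = 1\<^sub>m n"
    and "the (mat_inverse A) \<in> carrier_mat n n"
proof -
  have A: "A \<in> carrier_mat n n"
    unfolding A_def by (rule mass_mat_carrier)
  have "v = 0\<^sub>v n" if v: "v \<in> carrier_vec n" and Av: "A *\<^sub>v v = 0\<^sub>v n" for v
  proof -
    define s where "s = (\<lambda>e. \<Sum>j<n. Matrix.vec_index v j * y j e)"
    have "(LINT e|lebesgue_on {0..emax}. 1 * (s e)\<^sup>2 * e\<^sup>2) = 0"
      using mass_mat_quadratic_form(2)[where g = "\<lambda>_. 1" and y = y, OF int v] Av v
      by (simp add: s_def A_def)
    then have "AE e in lebesgue_on {0..emax}. 1 * (s e)\<^sup>2 * e\<^sup>2 = 0"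
      using mass_mat_quadratic_form(1)[where g = "\<lambda>_. 1" and y = y, OF int v]
      by (subst (asm) integral_nonneg_eq_0_iff_AE) (auto simp: s_def)
    moreover have "AE e in lebesgue_on {0..emax}. e \<noteq> 0"
    proof -
      have "AE e in lebesgue. e \<noteq> (0::real)"
        by (intro AE_completion AE_lborel_singleton)
      then show ?thesis
        by (auto simp: AE_restrict_space_iff)
    qed
    ultimately have "AE e in lebesgue_on {0..emax}. (s e)\<^sup>2 = 0"
      by eventually_elim auto
    then have "(LINT e|lebesgue_on {0..emax}. (s e)\<^sup>2) = 0"
      by (intro integral_eq_zero_AE)
    also have "(\<lambda>e. (s e)\<^sup>2) = (\<lambda>e. \<Sum>i<n. \<Sum>j<n. (Matrix.vec_index v i * Matrix.vec_index v j) * (y i e * y j e))"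
      by (simp add: s_def power2_eq_square sum_product mult_ac)
    also have "(LINT e|lebesgue_on {0..emax}. (\<Sum>i<n. \<Sum>j<n. (Matrix.vec_index v i * Matrix.vec_index v j) * (y i e * y j e)))
      = (\<Sum>i<n. \<Sum>j<n. (Matrix.vec_index v i * Matrix.vec_index v j) * (if i = j then 1 else 0))"
      using int1 orth by (subst integral_double_sum(2)) auto
    also have "\<dots> = (\<Sum>i<n. Matrix.vec_index v i * Matrix.vec_index v i)"
      by (simp add: if_distrib cong: if_cong)
    finally have "\<forall>i<n. Matrix.vec_index v i = 0"
      by (subst (asm) sum_nonneg_eq_0_iff) auto
    then show ?thesis
      using v by (intro eq_vecI) auto
  qed
  then have "det A \<noteq> 0"
    using det_0_iff_vec_prod_zero_field[OF A] by blast
  then have "A \<in> Units (ring_mat TYPE(real) n ())"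
    by (rule det_non_zero_imp_unit[OF A])
  then obtain B where "mat_inverse A = Some B"
    using mat_inverse(1)[OF A, where b = "()"] by (cases "mat_inverse A") auto
  then show "A * the (mat_inverse A) = 1\<^sub>m n" "the (mat_inverse A) * A = 1\<^sub>m n"
    "the (mat_inverse A) \<in> carrier_mat n n"
    using mat_inverse(2)[OF A] by auto
qed

section \<open>The Galerkin step as an orthogonality condition on the residual\<close>

text \<open>The first three assumptions are the conclusions of \<open>winner_coeff_fun\<close> and \<open>winner_source\<close>; taking
  them as hypotheses keeps this step purely algebraic.\<close>

lemma galerkin_step_iff_residual:
  assumes winner_one: "\<And>F W. F \<in> carrier_mat m n \<Longrightarrow> W \<in> carrier_mat m n \<Longrightarrow>
      winner emax (\<lambda>u e. 1 * coeff_fun m n x y F u e) (coeff_fun m n x y W)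
        = frob (F * mass_mat emax n y (\<lambda>_. 1)) W"
    and winner_chi: "\<And>F W. F \<in> carrier_mat m n \<Longrightarrow> W \<in> carrier_mat m n \<Longrightarrow>
      winner emax (\<lambda>u e. chi e * coeff_fun m n x y F u e) (coeff_fun m n x y W)
        = frob (F * mass_mat emax n y chi) W"
    and winner_eta: "\<And>W. W \<in> carrier_mat m n \<Longrightarrow>
      winner emax (\<lambda>u e. eta e) (coeff_fun m n x y W)
        = frob (L_zero m x * transpose_mat (L_eta emax n y eta)) W"
    and F_old: "F_old \<in> carrier_mat m n" and P: "P \<in> carrier_mat m a" and Q: "Q \<in> carrier_mat n b"
    and Z: "Z \<in> carrier_mat a b" and F: "F = P * Z * transpose_mat Q"
    and V: "V = {coeff_fun m n x y (P * Z * transpose_mat Q) | Z. Z \<in> carrier_mat a b}"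
  shows "galerkin_step emax eta chi dt V (coeff_fun m n x y F_old) (coeff_fun m n x y F) \<longleftrightarrow>
    transpose_mat P * ((1 / dt) \<cdot>\<^sub>m (F - F_old) * mass_mat emax n y (\<lambda>_. 1)
      - G_mat emax m n x y eta chi F) * Q = 0\<^sub>m a b"
proof -
  let ?M = "(1 / dt) \<cdot>\<^sub>m (F - F_old) * mass_mat emax n y (\<lambda>_. 1)"
  let ?G = "G_mat emax m n x y eta chi F"
  have F_carrier: "F \<in> carrier_mat m n"
    unfolding F by (intro mult_carrier_mat[OF mult_carrier_mat[OF P Z]]) (use Q in simp)
  have L_carrier: "L_zero m x * transpose_mat (L_eta emax n y eta) \<in> carrier_mat m n"
    by (rule mult_carrier_mat[of _ m 1]) (auto simp: L_zero_def L_eta_def)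
  have M_carrier: "?M \<in> carrier_mat m n"
    by (intro mult_carrier_mat[OF _ mass_mat_carrier] smult_carrier_mat minus_carrier_mat F_old)
  have G_carrier: "?G \<in> carrier_mat m n"
    by (rule G_mat_carrier[OF F_carrier])
  have tested: "winner emax (\<lambda>u e. (coeff_fun m n x y F u e - coeff_fun m n x y F_old u e) / dt)
        (coeff_fun m n x y W)
      = form_A emax eta chi (coeff_fun m n x y F) (coeff_fun m n x y W)
    \<longleftrightarrow> frob (?M - ?G) W = 0" if W: "W \<in> carrier_mat m n" for W
  proof -
    \<comment> \<open>The difference quotient has a coefficient matrix itself; the factor 1 is the weight \<open>g = 1\<close>.\<close>
    have quotient: "(\<lambda>u e. (coeff_fun m n x y F u e - coeff_fun m n x y F_old u e) / dt)
        = (\<lambda>u e. 1 * coeff_fun m n x y ((1 / dt) \<cdot>\<^sub>m (F - F_old)) u e)"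
      by (simp add: coeff_fun_scaled_diff[OF F_carrier F_old])
    have "winner emax (\<lambda>u e. (coeff_fun m n x y F u e - coeff_fun m n x y F_old u e) / dt)
        (coeff_fun m n x y W) = frob ?M W"
      unfolding quotient by (intro winner_one smult_carrier_mat minus_carrier_mat F_old W)
    moreover have "form_A emax eta chi (coeff_fun m n x y F) (coeff_fun m n x y W) = frob ?G W"
      unfolding form_A_def G_mat_def winner_chi[OF F_carrier W] winner_eta[OF W]
      by (rule frob_diff_left[OF L_carrier mult_carrier_mat[OF F_carrier mass_mat_carrier], symmetric])
    ultimately show ?thesis
      by (simp add: frob_diff_left[OF M_carrier G_carrier])
  qed
  have test_carrier: "P * Z' * transpose_mat Q \<in> carrier_mat m n" if "Z' \<in> carrier_mat a b" for Z'
    by (intro mult_carrier_mat[OF mult_carrier_mat[OF P that]]) (use Q in simp)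
  have "galerkin_step emax eta chi dt V (coeff_fun m n x y F_old) (coeff_fun m n x y F) \<longleftrightarrow>
      (\<forall>Z'\<in>carrier_mat a b.
        winner emax (\<lambda>u e. (coeff_fun m n x y F u e - coeff_fun m n x y F_old u e) / dt)
          (coeff_fun m n x y (P * Z' * transpose_mat Q))
        = form_A emax eta chi (coeff_fun m n x y F) (coeff_fun m n x y (P * Z' * transpose_mat Q)))"
    unfolding galerkin_step_def V F using Z by blast
  also have "\<dots> \<longleftrightarrow> (\<forall>Z'\<in>carrier_mat a b. frob (?M - ?G) (P * Z' * transpose_mat Q) = 0)"
    by (intro ball_cong refl tested test_carrier)
  also have "\<dots> \<longleftrightarrow> transpose_mat P * (?M - ?G) * Q = 0\<^sub>m a b"
    by (intro frob_orthogonal_sandwich_iff[OF _ P Q] minus_carrier_mat G_carrier)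
  finally show ?thesis .
qed

section \<open>Residuals of the low-rank steps\<close>

lemma sandwiched_residual:
  fixes F F0 A H P Q :: "real mat"
  assumes F: "F \<in> carrier_mat m n" and F0: "F0 \<in> carrier_mat m n" and A: "A \<in> carrier_mat n n"
    and H: "H \<in> carrier_mat m n" and P: "P \<in> carrier_mat m a" and Q: "Q \<in> carrier_mat n b"
  shows "transpose_mat P * (c \<cdot>\<^sub>m (F - F0) * A - H) * Q
    = c \<cdot>\<^sub>m (transpose_mat P * F * A * Q - transpose_mat P * F0 * A * Q) - transpose_mat P * H * Q"
proof -
  have PT: "transpose_mat P \<in> carrier_mat a m"
    using P by simp
  have "c \<cdot>\<^sub>m (F - F0) * A = c \<cdot>\<^sub>m (F * A - F0 * A)"
    using F F0 A by (simp add: minus_carrier_mat minus_mult_distrib_mat[of _ m n] mult_smult_assoc_mat[of _ m n _ n])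
  moreover have "transpose_mat P * (c \<cdot>\<^sub>m (F * A - F0 * A) - H)
      = c \<cdot>\<^sub>m (transpose_mat P * (F * A) - transpose_mat P * (F0 * A)) - transpose_mat P * H"
    using assms by (simp add: minus_carrier_mat mult_minus_distrib_mat[of _ a m _ n] mult_smult_distrib[of _ a m _ n])
  moreover have "(c \<cdot>\<^sub>m (transpose_mat P * (F * A) - transpose_mat P * (F0 * A)) - transpose_mat P * H) * Q
      = c \<cdot>\<^sub>m (transpose_mat P * (F * A) * Q - transpose_mat P * (F0 * A) * Q) - transpose_mat P * H * Q"
    using assms by (simp add: minus_carrier_mat minus_mult_distrib_mat[of _ a n _ _ b] mult_smult_assoc_mat[of _ a n _ b])
  ultimately show ?thesis
    by (simp only: assoc_mult_mat[OF PT F A] assoc_mult_mat[OF PT F0 A])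
qed

lemma minus_mat_eq_zero_iff:
  fixes A B :: "real mat"
  assumes "A \<in> carrier_mat m n" "B \<in> carrier_mat m n"
  shows "A - B = 0\<^sub>m m n \<longleftrightarrow> A = B"
  using assms by (auto simp: mat_eq_iff)

lemma mult_weighted_orthonormal:
  fixes B Q A :: "real mat"
  assumes B: "B \<in> carrier_mat m b" and Q: "Q \<in> carrier_mat n b" and A: "A \<in> carrier_mat n n"
    and Q_orth: "transpose_mat Q * A * Q = 1\<^sub>m b"
  shows "B * transpose_mat Q * A * Q = B"
proof -
  have QT: "transpose_mat Q \<in> carrier_mat b n"
    using Q by simp
  have "B * transpose_mat Q * A * Q = B * (transpose_mat Q * A) * Q"
    by (simp only: assoc_mult_mat[OF B QT A])
  also have "\<dots> = B * (transpose_mat Q * A * Q)"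
    by (rule assoc_mult_mat[OF B mult_carrier_mat[OF QT A] Q])
  finally show ?thesis
    unfolding Q_orth right_mult_one_mat[OF B] .
qed

text \<open>With both factors normalised, the unknown \<open>Z\<close> appears without coefficients, and the old iterate
  enters through its projection. This serves the S-step, and the K-step with \<open>P\<close> the identity.\<close>

lemma normalised_residual_eq_zero_iff:
  fixes P Q A Z F0 H :: "real mat"
  assumes P: "P \<in> carrier_mat m a" and P_orth: "transpose_mat P * P = 1\<^sub>m a"
    and Q: "Q \<in> carrier_mat n b" and Q_orth: "transpose_mat Q * A * Q = 1\<^sub>m b"
    and A: "A \<in> carrier_mat n n" and Z: "Z \<in> carrier_mat a b"
    and F0: "F0 \<in> carrier_mat m n" and H: "H \<in> carrier_mat m n"
  shows "transpose_mat P * (c \<cdot>\<^sub>m (P * Z * transpose_mat Q - F0) * A - H) * Q = 0\<^sub>m a b \<longleftrightarrow>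
    c \<cdot>\<^sub>m (Z - transpose_mat P * F0 * A * Q) = transpose_mat P * H * Q"
proof -
  have PT: "transpose_mat P \<in> carrier_mat a m" and QT: "transpose_mat Q \<in> carrier_mat b n"
    using P Q by simp_all
  note F = mult_carrier_mat[OF mult_carrier_mat[OF P Z] QT]
  have "transpose_mat P * (P * Z * transpose_mat Q) = transpose_mat P * P * Z * transpose_mat Q"
    by (simp only: assoc_mult_mat[OF PT mult_carrier_mat[OF P Z] QT] assoc_mult_mat[OF PT P Z])
  then have projected: "transpose_mat P * (P * Z * transpose_mat Q) * A * Q = Z"
    by (simp only: P_orth left_mult_one_mat[OF Z] mult_weighted_orthonormal[OF Z Q A Q_orth])
  show ?thesis
    unfolding sandwiched_residual[OF F F0 A H P Q] projected
    by (intro minus_mat_eq_zero_iff smult_carrier_mat minus_carrier_mat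
        mult_carrier_mat[OF mult_carrier_mat[OF mult_carrier_mat[OF PT F0] A] Q]
        mult_carrier_mat[OF mult_carrier_mat[OF PT H] Q])
qed

text \<open>In the L-step the right factor is the identity, which is not normalised for the weight \<open>A\<close>.
  Transposing the residual moves the symmetric \<open>A\<close> to the left, where its inverse \<open>B\<close> cancels it.\<close>

lemma left_normalised_residual_eq_zero_iff:
  fixes U A B L L0 H :: "real mat"
  assumes U: "U \<in> carrier_mat m r" and U_orth: "transpose_mat U * U = 1\<^sub>m r"
    and A: "A \<in> carrier_mat n n" and A_sym: "transpose_mat A = A"
    and B: "B \<in> carrier_mat n n" and AB: "A * B = 1\<^sub>m n" and BA: "B * A = 1\<^sub>m n"
    and L: "L \<in> carrier_mat n r" and L0: "L0 \<in> carrier_mat n r" and H: "H \<in> carrier_mat m n"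
  shows "transpose_mat U * (c \<cdot>\<^sub>m (U * transpose_mat L - U * transpose_mat L0) * A - H) * 1\<^sub>m n
      = 0\<^sub>m r n \<longleftrightarrow>
    c \<cdot>\<^sub>m (L - L0) = B * transpose_mat H * U"
proof -
  let ?D = "c \<cdot>\<^sub>m (L - L0)" and ?J = "transpose_mat H * U"
  have UT: "transpose_mat U \<in> carrier_mat r m" and HT: "transpose_mat H \<in> carrier_mat n m"
    and LT: "transpose_mat L \<in> carrier_mat r n" and L0T: "transpose_mat L0 \<in> carrier_mat r n"
    using U H L L0 by simp_all
  have D: "?D \<in> carrier_mat n r"
    by (intro smult_carrier_mat minus_carrier_mat L0)
  note J = mult_carrier_mat[OF HT U]
  note AD = mult_carrier_mat[OF A D]
  have absorb: "transpose_mat U * (U * C) = C" if "C \<in> carrier_mat r n" for C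
    by (simp only: assoc_mult_mat[OF UT U that, symmetric] U_orth left_mult_one_mat[OF that])
  have "transpose_mat ?D = c \<cdot>\<^sub>m (transpose_mat L - transpose_mat L0)"
    using L L0 by (intro eq_matI) auto
  then have "transpose_mat (A * ?D) = c \<cdot>\<^sub>m (transpose_mat L * A - transpose_mat L0 * A)"
    by (simp only: transpose_mult[OF A D] A_sym minus_mult_distrib_mat[OF LT L0T A]
        mult_smult_assoc_mat[OF minus_carrier_mat[OF L0T] A])
  moreover have "transpose_mat ?J = transpose_mat U * H"
    by (simp only: transpose_mult[OF HT U] transpose_transpose)
  moreover have "transpose_mat U * (c \<cdot>\<^sub>m (U * transpose_mat L - U * transpose_mat L0) * A - H) * 1\<^sub>m n
      = c \<cdot>\<^sub>m (transpose_mat L * A - transpose_mat L0 * A) - transpose_mat U * H"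
    unfolding sandwiched_residual[OF mult_carrier_mat[OF U LT] mult_carrier_mat[OF U L0T] A H U
        one_carrier_mat] absorb[OF LT] absorb[OF L0T]
    by (simp only: right_mult_one_mat[OF mult_carrier_mat[OF LT A]]
        right_mult_one_mat[OF mult_carrier_mat[OF L0T A]] right_mult_one_mat[OF mult_carrier_mat[OF UT H]])
  ultimately have "transpose_mat U * (c \<cdot>\<^sub>m (U * transpose_mat L - U * transpose_mat L0) * A - H) * 1\<^sub>m n
      = transpose_mat (A * ?D - ?J)"
    by (simp only: transpose_minus[OF AD J])
  then have "transpose_mat U * (c \<cdot>\<^sub>m (U * transpose_mat L - U * transpose_mat L0) * A - H) * 1\<^sub>m n
      = 0\<^sub>m r n \<longleftrightarrow> transpose_mat (A * ?D - ?J) = transpose_mat (0\<^sub>m n r)"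
    by simp
  also have "\<dots> \<longleftrightarrow> A * ?D - ?J = 0\<^sub>m n r"
    by (rule transpose_mat_eq)
  also have "\<dots> \<longleftrightarrow> A * ?D = ?J"
    by (rule minus_mat_eq_zero_iff[OF AD J])
  also have "\<dots> \<longleftrightarrow> ?D = B * ?J"
  proof
    assume "A * ?D = ?J"
    then have "B * ?J = B * A * ?D"
      using assoc_mult_mat[OF B A D] by (simp only:)
    then show "?D = B * ?J"
      unfolding BA left_mult_one_mat[OF D] by (rule sym)
  next
    assume "?D = B * ?J"
    then have "A * ?D = A * B * ?J"
      using assoc_mult_mat[OF A B J] by (simp only:)
    then show "A * ?D = ?J"
      unfolding AB left_mult_one_mat[OF J] .
  qed
  also have "B * ?J = B * transpose_mat H * U"
    by (rule assoc_mult_mat[OF B HT U, symmetric])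
  finally show ?thesis .
qed

lemma V_one_sandwich:
  "V_one m n r x y E = {coeff_fun m n x y (1\<^sub>m m * Z * transpose_mat E) | Z. Z \<in> carrier_mat m r}"
  unfolding V_one_def by (intro Collect_cong ex_cong1) (auto simp only: left_mult_one_mat)

text \<open>The free factor of the sandwich form is the transpose of the one in \<open>V\<^sub>2\<close>.\<close>

lemma V_two_sandwich:
  assumes U: "U \<in> carrier_mat m r"
  shows "V_two m n r x y U
    = {coeff_fun m n x y (U * Z * transpose_mat (1\<^sub>m n)) | Z. Z \<in> carrier_mat r n}"
proof -
  have drop_one: "U * Z * transpose_mat (1\<^sub>m n) = U * Z" if "Z \<in> carrier_mat r n" for Z
    unfolding transpose_one by (rule right_mult_one_mat[OF mult_carrier_mat[OF U that]])
  show ?thesis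
  proof (intro equalityI subsetI)
    fix f assume "f \<in> V_two m n r x y U"
    then obtain L where L: "f = coeff_fun m n x y (U * transpose_mat L)" "L \<in> carrier_mat n r"
      unfolding V_two_def by blast
    then have "transpose_mat L \<in> carrier_mat r n"
      by simp
    with L(1) drop_one[OF this]
    show "f \<in> {coeff_fun m n x y (U * Z * transpose_mat (1\<^sub>m n)) | Z. Z \<in> carrier_mat r n}"
      by (intro CollectI exI[of _ "transpose_mat L"]) simp
  next
    fix f assume "f \<in> {coeff_fun m n x y (U * Z * transpose_mat (1\<^sub>m n)) | Z. Z \<in> carrier_mat r n}"
    then obtain Z where Z: "f = coeff_fun m n x y (U * Z * transpose_mat (1\<^sub>m n))" "Z \<in> carrier_mat r n"
      by blast
    then have "f = coeff_fun m n x y (U * transpose_mat (transpose_mat Z))" "transpose_mat Z \<in> carrier_mat n r"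
      by (simp_all only: drop_one[OF Z(2)] transpose_transpose transpose_carrier_mat)
    then show "f \<in> V_two m n r x y U"
      unfolding V_two_def by blast
  qed
qed

section \<open>The equivalence for the three steps\<close>

theorem lemma4p2:
  fixes emax dt chi_min chi_max :: real
    and eta chi :: "real \<Rightarrow> real"
    and k N_mu N_eps m n r :: nat
    and p q :: "nat \<Rightarrow> real"
    and x y :: "nat \<Rightarrow> real \<Rightarrow> real"
    and A1 U S E K L U' E' S' S_star R_K R_L :: "real mat"
    and G :: "real mat \<Rightarrow> real mat"
    and f_hat f_K f_L f_S :: "real \<Rightarrow> real \<Rightarrow> real"
  assumes emax: "0 < emax" and dt: "0 < dt"
    and eta_meas: "eta \<in> borel_measurable (lebesgue_on {0..emax})"
    and eta_sq_int: "integrable (lebesgue_on {0..emax}) (\<lambda>e. (eta e)\<^sup>2 * e\<^sup>2)"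
    and eta_pos: "\<forall>e\<in>{0..emax}. 0 < eta e"
    and chi_meas: "chi \<in> borel_measurable (lebesgue_on {0..emax})"
    and chi_min: "0 < chi_min"
    and chi_bounds: "\<forall>e\<in>{0..emax}. chi_min \<le> chi e \<and> chi e \<le> chi_max"
    and part_mu: "partition_nodes (-1) 1 N_mu p"
    and part_eps: "partition_nodes 0 emax N_eps q"
    and m: "m = (k + 1) * N_mu" and n: "n = (k + 1) * N_eps"
    and r: "1 \<le> r" "r \<le> min m n"
    and basis_mu: "legendre_basis k N_mu p x"
    and basis_eps: "legendre_basis k N_eps q y"
    and A1: "A1 = mass_mat emax n y (\<lambda>_. 1)"
    and G: "G = G_mat emax m n x y eta chi"
    and U: "U \<in> carrier_mat m r" "transpose_mat U * U = 1\<^sub>m r"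
    and S: "S \<in> carrier_mat r r"
    and E: "E \<in> carrier_mat n r" "transpose_mat E * A1 * E = 1\<^sub>m r"
    and K: "K \<in> carrier_mat m r"
    and L: "L \<in> carrier_mat n r"
    and S': "S' \<in> carrier_mat r r"
    and U': "U' \<in> carrier_mat m r" "transpose_mat U' * U' = 1\<^sub>m r"
    and K_decomp: "R_K \<in> carrier_mat r r" "K = U' * R_K"
    and E': "E' \<in> carrier_mat n r" "transpose_mat E' * A1 * E' = 1\<^sub>m r"
    and L_decomp: "R_L \<in> carrier_mat r r" "L = E' * R_L"
    and S_star: "S_star = transpose_mat U' * U * S * transpose_mat E * A1 * E'"
    and f_hat: "f_hat = coeff_fun m n x y (U * S * transpose_mat E)"
    and f_K: "f_K = coeff_fun m n x y (K * transpose_mat E)"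
    and f_L: "f_L = coeff_fun m n x y (U * transpose_mat L)"
    and f_S: "f_S = coeff_fun m n x y (U' * S' * transpose_mat E')"
  shows "((1 / dt) \<cdot>\<^sub>m (K - U * S) = G (K * transpose_mat E) * E \<longleftrightarrow>
            galerkin_step emax eta chi dt (V_one m n r x y E) f_hat f_K) \<and>
         ((1 / dt) \<cdot>\<^sub>m (L - E * transpose_mat S) =
              the (mat_inverse A1) * transpose_mat (G (U * transpose_mat L)) * U \<longleftrightarrow>
            galerkin_step emax eta chi dt (V_two m n r x y U) f_hat f_L) \<and>
         ((1 / dt) \<cdot>\<^sub>m (S' - S_star) =
              transpose_mat U' * G (U' * S' * transpose_mat E') * E' \<longleftrightarrow>
            galerkin_step emax eta chi dt (V_zero m n r x y U' E') f_hat f_S)"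
proof -
  let ?c = "1 / dt"
  define F0 where "F0 = U * S * transpose_mat E"
  have p_ends: "p 0 = -1" "p N_mu = 1" and q_ends: "q 0 = 0" "q N_eps = emax"
    using part_mu part_eps unfolding partition_nodes_def by blast+
  have orth_x: "(LINT u|lebesgue_on {-1..1}. x i u * x j u) = (if i = j then 1 else 0)"
    if "i < m" "j < m" for i j
    using basis_mu that unfolding legendre_basis_def p_ends m by blast
  have orth_y: "(LINT e|lebesgue_on {0..emax}. y i e * y j e) = (if i = j then 1 else 0)"
    if "i < n" "j < n" for i j
    using basis_eps that unfolding legendre_basis_def q_ends n by blast
  have int_x: "integrable (lebesgue_on {-1..1}) (\<lambda>u. x i u * x j u)" if "i < m" "j < m" for i j
    using integrable_basis_product[OF basis_mu that[unfolded m]] .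
  have int_y: "integrable (lebesgue_on {0..emax}) (\<lambda>e. y i e * y j e)" if "i < n" "j < n" for i j
    using integrable_basis_product[OF basis_eps that[unfolded n]] .
  have int_one: "integrable (lebesgue_on {0..emax}) (\<lambda>e. 1 * y i e * y j e * e\<^sup>2)"
    if "i < n" "j < n" for i j
    by (rule integrable_squared_weight_product[OF basis_eps that[unfolded n] borel_measurable_const,
          where B = 1])
      (simp only: abs_one order_refl)
  have int_chi: "integrable (lebesgue_on {0..emax}) (\<lambda>e. chi e * y i e * y j e * e\<^sup>2)"
    if "i < n" "j < n" for i j
  proof (rule integrable_squared_weight_product[OF basis_eps that[unfolded n] chi_meas])
    show "\<bar>chi e\<bar> \<le> chi_max" if "e \<in> {0..emax}" for e
    proof -
      have "chi_min \<le> chi e" "chi e \<le> chi_max"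
        using bspec[OF chi_bounds that] by (rule conjunct1, rule conjunct2)
      then show ?thesis
        using chi_min by linarith
    qed
  qed
  have int_eta: "integrable (lebesgue_on {0..emax}) (\<lambda>e. eta e * y j e * e\<^sup>2)" if "j < n" for j
    by (rule integrable_source_basis[OF basis_eps that[unfolded n] eta_meas eta_sq_int])
  have int_x1: "integrable (lebesgue_on {-1..1}) (x i)" if "i < m" for i
    by (rule integrable_basis[OF basis_mu that[unfolded m]])
  have winner_one: "winner emax (\<lambda>u e. 1 * coeff_fun m n x y F u e) (coeff_fun m n x y W)
      = frob (F * mass_mat emax n y (\<lambda>_. 1)) W"
    if "F \<in> carrier_mat m n" "W \<in> carrier_mat m n" for F W
    using winner_coeff_fun[where g = "\<lambda>_. 1" and x = x and y = y, OF int_x orth_x int_one that] .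
  have winner_chi: "winner emax (\<lambda>u e. chi e * coeff_fun m n x y F u e) (coeff_fun m n x y W)
      = frob (F * mass_mat emax n y chi) W"
    if "F \<in> carrier_mat m n" "W \<in> carrier_mat m n" for F W
    using winner_coeff_fun[where g = chi and x = x and y = y, OF int_x orth_x int_chi that] .
  have winner_eta: "winner emax (\<lambda>u e. eta e) (coeff_fun m n x y W)
      = frob (L_zero m x * transpose_mat (L_eta emax n y eta)) W"
    if "W \<in> carrier_mat m n" for W
    using winner_source[where x = x and y = y, OF int_x1 int_eta that] .

  have A1c: "A1 \<in> carrier_mat n n" and A1_sym: "transpose_mat A1 = A1"
    unfolding A1 by (rule mass_mat_carrier, rule mass_mat_symmetric)
  have Gc: "G F \<in> carrier_mat m n" if "F \<in> carrier_mat m n" for F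
    unfolding G using that by (rule G_mat_carrier)
  have ET: "transpose_mat E \<in> carrier_mat r n"
    using E(1) by simp
  note US = mult_carrier_mat[OF U(1) S]
  have F0c: "F0 \<in> carrier_mat m n"
    unfolding F0_def by (rule mult_carrier_mat[OF US ET])
  have step: "galerkin_step emax eta chi dt V (coeff_fun m n x y F0) (coeff_fun m n x y F) \<longleftrightarrow>
      transpose_mat P * (?c \<cdot>\<^sub>m (F - F0) * A1 - G F) * Q = 0\<^sub>m a b"
    if "P \<in> carrier_mat m a" "Q \<in> carrier_mat n b" "Z \<in> carrier_mat a b"
      "F = P * Z * transpose_mat Q"
      "V = {coeff_fun m n x y (P * Z * transpose_mat Q) | Z. Z \<in> carrier_mat a b}"
    for P Q Z F V a b
    unfolding A1 G
    by (rule galerkin_step_iff_residual[OF winner_one winner_chi winner_eta F0c that])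

  have K_step: "?c \<cdot>\<^sub>m (K - U * S) = G (K * transpose_mat E) * E \<longleftrightarrow>
      galerkin_step emax eta chi dt (V_one m n r x y E) f_hat f_K"
  proof -
    let ?F = "K * transpose_mat E"
    have one: "1\<^sub>m m * K * transpose_mat E = ?F"
      by (simp only: left_mult_one_mat[OF K])
    note GF = Gc[OF mult_carrier_mat[OF K ET]]
    have "galerkin_step emax eta chi dt (V_one m n r x y E) f_hat f_K \<longleftrightarrow>
        transpose_mat (1\<^sub>m m) * (?c \<cdot>\<^sub>m (1\<^sub>m m * K * transpose_mat E - F0) * A1 - G ?F) * E = 0\<^sub>m m r"
      unfolding f_hat f_K F0_def[symmetric] one
      by (rule step[OF one_carrier_mat E(1) K one[symmetric] V_one_sandwich])
    also have "\<dots> \<longleftrightarrow> ?c \<cdot>\<^sub>m (K - transpose_mat (1\<^sub>m m) * F0 * A1 * E) = transpose_mat (1\<^sub>m m) * G ?F * E"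
      by (rule normalised_residual_eq_zero_iff[OF one_carrier_mat _ E A1c K F0c GF])
        (simp only: transpose_one left_mult_one_mat[OF one_carrier_mat])
    also have "transpose_mat (1\<^sub>m m) * F0 * A1 * E = U * S"
      unfolding transpose_one left_mult_one_mat[OF F0c] unfolding F0_def
      by (rule mult_weighted_orthonormal[OF US E(1) A1c E(2)])
    also have "transpose_mat (1\<^sub>m m) * G ?F * E = G ?F * E"
      by (simp only: transpose_one left_mult_one_mat[OF GF])
    finally show ?thesis
      by (rule sym)
  qed

  have L_step: "?c \<cdot>\<^sub>m (L - E * transpose_mat S) =
        the (mat_inverse A1) * transpose_mat (G (U * transpose_mat L)) * U \<longleftrightarrow>
      galerkin_step emax eta chi dt (V_two m n r x y U) f_hat f_L"
  proof -
    let ?F = "U * transpose_mat L" and ?B = "the (mat_inverse A1)"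
    have inv: "A1 * ?B = 1\<^sub>m n" "?B * A1 = 1\<^sub>m n" "?B \<in> carrier_mat n n"
      unfolding A1 by (rule mass_mat_inverse[OF int_one int_y orth_y]; assumption)+
    have LT: "transpose_mat L \<in> carrier_mat r n" and ST: "transpose_mat S \<in> carrier_mat r r"
      using L S by simp_all
    have one: "?F = U * transpose_mat L * transpose_mat (1\<^sub>m n)"
      by (simp only: transpose_one right_mult_one_mat[OF mult_carrier_mat[OF U(1) LT]])
    have F0_factored: "F0 = U * transpose_mat (E * transpose_mat S)"
      by (simp only: F0_def transpose_mult[OF E(1) ST] transpose_transpose assoc_mult_mat[OF U(1) S ET])
    have "galerkin_step emax eta chi dt (V_two m n r x y U) f_hat f_L \<longleftrightarrow>
        transpose_mat U * (?c \<cdot>\<^sub>m (?F - F0) * A1 - G ?F) * 1\<^sub>m n = 0\<^sub>m r n"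
      unfolding f_hat f_L F0_def[symmetric]
      by (rule step[OF U(1) one_carrier_mat LT one V_two_sandwich[OF U(1)]])
    also have "\<dots> \<longleftrightarrow> ?c \<cdot>\<^sub>m (L - E * transpose_mat S) = ?B * transpose_mat (G ?F) * U"
      unfolding F0_factored
      by (rule left_normalised_residual_eq_zero_iff[OF U A1c A1_sym inv(3,1,2) L
            mult_carrier_mat[OF E(1) ST] Gc[OF mult_carrier_mat[OF U(1) LT]]])
    finally show ?thesis
      by (rule sym)
  qed

  have S_step: "?c \<cdot>\<^sub>m (S' - S_star) = transpose_mat U' * G (U' * S' * transpose_mat E') * E' \<longleftrightarrow>
      galerkin_step emax eta chi dt (V_zero m n r x y U' E') f_hat f_S"
  proof -
    let ?F = "U' * S' * transpose_mat E'"
    have E'T: "transpose_mat E' \<in> carrier_mat r n" and U'T: "transpose_mat U' \<in> carrier_mat r m"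
      using E'(1) U'(1) by simp_all
    have projection: "S_star = transpose_mat U' * F0 * A1 * E'"
      by (simp only: S_star F0_def assoc_mult_mat[OF U'T US ET] assoc_mult_mat[OF U'T U(1) S])
    have "galerkin_step emax eta chi dt (V_zero m n r x y U' E') f_hat f_S \<longleftrightarrow>
        transpose_mat U' * (?c \<cdot>\<^sub>m (?F - F0) * A1 - G ?F) * E' = 0\<^sub>m r r"
      unfolding f_hat f_S F0_def[symmetric]
      by (rule step[OF U'(1) E'(1) S' refl V_zero_def])
    also have "\<dots> \<longleftrightarrow> ?c \<cdot>\<^sub>m (S' - S_star) = transpose_mat U' * G ?F * E'"
      unfolding projection
      by (rule normalised_residual_eq_zero_iff[OF U' E' A1c S' F0c
            Gc[OF mult_carrier_mat[OF mult_carrier_mat[OF U'(1) S'] E'T]]])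
    finally show ?thesis
      by (rule sym)
  qed

  show ?thesis
    using K_step L_step S_step by blast
qed

end
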